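(* Let $A$ be one of the algebras $A_r$, $B_r$ and $C_r$. Then $A$ can be positively graded.
   Context: $k$ is an algebraically closed field of characteristic 2. A grading on a $k$-algebra $A$ is a decomposition of $A$ as a direct sum of subspaces $A=\bigoplus_{i\in\mathbb{Z}}A_i$ with $A_iA_j\subseteq A_{i+j}$ for all $i,j\in\mathbb{Z}$. If $A_i=0$ for $i<0$, then $A$ is said to be positively graded. Algebras are given by quivers with relations (quotients of path algebras over $k$); paths are written left to right, i.e. $xy$ means first $x$, then $y$. $A_r$ ($r\ge1$): vertices $1,2,3$; arrows $a_1:1\to2$, $a_2:2\to1$, $b_1:1\to3$, $b_2:3\to1$; relations $a_2a_1=b_2b_1=0$, $(a_1a_2b_1b_2)^r=(b_1b_2a_1a_2)^r$. $B_r$ ($r\ge1$): vertices $1,2,3$; arrows $c_1:1\to2$, $c_2:2\to3$, $c_3:3\to1$, $d_1:2\to1$, $d_2:3\to2$, $d_3:1\to3$; relations $c_1c_2=c_2c_3=c_3c_1=0$, $d_1d_3=d_3d_2=d_2d_1=0$, $c_1d_1=d_3c_3$, $d_1c_1=(c_2d_2)^r$, $c_3d_3=(d_2c_2)^r$. $C_r$ ($r\ge2$): vertices $1,2,3$; arrows $a_1:1\to2$, $b_1:2\to1$, $a_2:2\to3$, $b_2:3\to2$, and a loop $c$ at $3$; relations $a_1b_1=b_2a_2=a_2c=cb_2=0$, $c^r=b_2b_1a_1a_2$, $a_2b_2b_1a_1=b_1a_1a_2b_2$. For $r=1$, $C_1:=A_1$. *)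

theory Defs
  imports
    "HOL-Algebra.Algebra"
    "HOL-Algebra.Algebraic_Closure_Type"
    "Graph_Theory.Arc_Walk"
begin

section \<open>Path algebras of quivers\<close>

text \<open>
  A path is a triple of start vertex, list of arrows and end vertex; the trivial path at
  a vertex \<open>u\<close> is \<open>(u, [], u)\<close>. Arrows are listed in the order in which they are traversed,
  so that a product of paths is read from left to right.
\<close>

type_synonym ('v, 'e) quiver_path = "'v \<times> 'e list \<times> 'v"

definition quiver_paths :: "('v, 'e) pre_digraph \<Rightarrow> ('v, 'e) quiver_path set" where
  "quiver_paths Q = {(u, p, v). pre_digraph.awalk Q u p v}"

text \<open>
  An element of the path algebra is its finitely supported coefficient function on paths.
  The coefficient of a product at a path is the sum over all ways of splitting that path in two.
  The identity, the sum of the trivial paths, is in the carrier when the quiver has finitely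
  many vertices.
\<close>

definition path_algebra ::
    "('v, 'e) pre_digraph \<Rightarrow> ('k :: field, ('v, 'e) quiver_path \<Rightarrow> 'k) module" where
  "path_algebra Q = \<lparr>
     carrier = {f. finite {x. f x \<noteq> 0} \<and> {x. f x \<noteq> 0} \<subseteq> quiver_paths Q},
     monoid.mult = (\<lambda>f g (u, p, v).
       \<Sum>(p1, w, p2) \<in> {(p1, w, p2). p1 @ p2 = p \<and> (u, p1, w) \<in> quiver_paths Q \<and>
                                   (w, p2, v) \<in> quiver_paths Q}.
         f (u, p1, w) * g (w, p2, v)),
     one = (\<lambda>x. if \<exists>u \<in> verts Q. x = (u, [], u) then 1 else 0),
     ring.zero = (\<lambda>x. 0),
     add = (\<lambda>f g x. f x + g x),
     module.smult = (\<lambda>a f x. a * f x)\<rparr>"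

text \<open>
  The basis element of the nontrivial path that traverses the given arrows, which are expected
  to form a nonempty consistent arc sequence.
\<close>

definition path_elt ::
    "('v, 'e) pre_digraph \<Rightarrow> 'e list \<Rightarrow> ('v, 'e) quiver_path \<Rightarrow> 'k :: field" where
  "path_elt Q es = (\<lambda>x. if x = (tail Q (hd es), es, head Q (last es)) then 1 else 0)"


section \<open>Quotient algebras and quivers with relations\<close>

definition quotient_algebra :: "('k, 'a) module \<Rightarrow> 'a set \<Rightarrow> ('k, 'a set) module" where
  "quotient_algebra A I = ring.extend (A Quot I)
     (module.fields (\<lambda>a M. \<Union>x \<in> M. I +>\<^bsub>A\<^esub> (a \<odot>\<^bsub>A\<^esub> x)))"

text \<open>A relation \<open>l = r\<close> is given as the pair \<open>(l, r)\<close>; \<^const>\<open>genideal\<close> is the two-sided ideal.\<close>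

definition quiver_algebra ::
    "('v, 'e) pre_digraph
      \<Rightarrow> ((('v, 'e) quiver_path \<Rightarrow> 'k) \<times> (('v, 'e) quiver_path \<Rightarrow> 'k)) set
      \<Rightarrow> ('k :: field, (('v, 'e) quiver_path \<Rightarrow> 'k) set) module" where
  "quiver_algebra Q R = quotient_algebra (path_algebra Q)
     (genideal (path_algebra Q) {l \<ominus>\<^bsub>path_algebra Q\<^esub> r | l r. (l, r) \<in> R})"


section \<open>Gradings\<close>

text \<open>
  The second condition says that the underlying space is the direct sum of the \<open>G i\<close>: every
  element is a sum of a unique finitely supported family of homogeneous components.
\<close>

definition is_grading :: "('k :: field, 'a) module \<Rightarrow> (int \<Rightarrow> 'a set) \<Rightarrow> bool" where
  "is_grading A G \<longleftrightarrow>
     (\<forall>i. submodule (G i) (ring_of_type_algebra :: 'k ring) A) \<and>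
     (\<forall>x \<in> carrier A. \<exists>!f. (\<forall>i. f i \<in> G i) \<and> finite {i. f i \<noteq> \<zero>\<^bsub>A\<^esub>} \<and>
        x = (\<Oplus>\<^bsub>A\<^esub>i \<in> {i. f i \<noteq> \<zero>\<^bsub>A\<^esub>}. f i)) \<and>
     (\<forall>i j. \<forall>x \<in> G i. \<forall>y \<in> G j. x \<otimes>\<^bsub>A\<^esub> y \<in> G (i + j))"

definition positive_grading :: "('k :: field, 'a) module \<Rightarrow> (int \<Rightarrow> 'a set) \<Rightarrow> bool" where
  "positive_grading A G \<longleftrightarrow> is_grading A G \<and> (\<forall>i < 0. G i = {\<zero>\<^bsub>A\<^esub>})"

text \<open>
  Every algebra is positively graded by the trivial grading, where \<open>G 0\<close> is the whole algebra and
  all other components vanish; this notion excludes it.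
\<close>

definition nontrivial_grading :: "('k :: field, 'a) module \<Rightarrow> (int \<Rightarrow> 'a set) \<Rightarrow> bool" where
  "nontrivial_grading A G \<longleftrightarrow> is_grading A G \<and> (\<exists>i. i \<noteq> 0 \<and> G i \<noteq> {\<zero>\<^bsub>A\<^esub>})"


section \<open>The algebras\<close>

text \<open>
  All three families share one type of arrows, so that they are algebras of the same type;
  \<open>c\<^sub>0\<close> stands for the loop \<open>c\<close>.
\<close>

datatype arrow = a\<^sub>1 | a\<^sub>2 | b\<^sub>1 | b\<^sub>2 | c\<^sub>0 | c\<^sub>1 | c\<^sub>2 | c\<^sub>3 | d\<^sub>1 | d\<^sub>2 | d\<^sub>3

text \<open>An entry \<open>(e, u, v)\<close> is an arrow \<open>e\<close> from \<open>u\<close> to \<open>v\<close>.\<close>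

definition quiver :: "'v set \<Rightarrow> ('e \<times> 'v \<times> 'v) list \<Rightarrow> ('v, 'e) pre_digraph" where
  "quiver V E = \<lparr>verts = V, arcs = fst ` set E,
     tail = (\<lambda>e. fst (the (map_of E e))), head = (\<lambda>e. snd (the (map_of E e)))\<rparr>"

definition quiver_A :: "(nat, arrow) pre_digraph" where
  "quiver_A = quiver {1, 2, 3} [(a\<^sub>1, 1, 2), (a\<^sub>2, 2, 1), (b\<^sub>1, 1, 3), (b\<^sub>2, 3, 1)]"

definition quiver_B :: "(nat, arrow) pre_digraph" where
  "quiver_B = quiver {1, 2, 3}
     [(c\<^sub>1, 1, 2), (c\<^sub>2, 2, 3), (c\<^sub>3, 3, 1), (d\<^sub>1, 2, 1), (d\<^sub>2, 3, 2), (d\<^sub>3, 1, 3)]"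

definition quiver_C :: "(nat, arrow) pre_digraph" where
  "quiver_C = quiver {1, 2, 3}
     [(a\<^sub>1, 1, 2), (b\<^sub>1, 2, 1), (a\<^sub>2, 2, 3), (b\<^sub>2, 3, 2), (c\<^sub>0, 3, 3)]"

definition algebra_A ::
    "nat \<Rightarrow> ('k :: field, ((nat, arrow) quiver_path \<Rightarrow> 'k) set) module" where
  "algebra_A r = (let P = path_algebra quiver_A; w = path_elt quiver_A in
     quiver_algebra quiver_A
      {(w [a\<^sub>2, a\<^sub>1], \<zero>\<^bsub>P\<^esub>), (w [b\<^sub>2, b\<^sub>1], \<zero>\<^bsub>P\<^esub>),
       (w [a\<^sub>1, a\<^sub>2, b\<^sub>1, b\<^sub>2] [^]\<^bsub>P\<^esub> r, w [b\<^sub>1, b\<^sub>2, a\<^sub>1, a\<^sub>2] [^]\<^bsub>P\<^esub> r)})"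

definition algebra_B ::
    "nat \<Rightarrow> ('k :: field, ((nat, arrow) quiver_path \<Rightarrow> 'k) set) module" where
  "algebra_B r = (let P = path_algebra quiver_B; w = path_elt quiver_B in
     quiver_algebra quiver_B
      {(w [c\<^sub>1, c\<^sub>2], \<zero>\<^bsub>P\<^esub>), (w [c\<^sub>2, c\<^sub>3], \<zero>\<^bsub>P\<^esub>), (w [c\<^sub>3, c\<^sub>1], \<zero>\<^bsub>P\<^esub>),
       (w [d\<^sub>1, d\<^sub>3], \<zero>\<^bsub>P\<^esub>), (w [d\<^sub>3, d\<^sub>2], \<zero>\<^bsub>P\<^esub>), (w [d\<^sub>2, d\<^sub>1], \<zero>\<^bsub>P\<^esub>),
       (w [c\<^sub>1, d\<^sub>1], w [d\<^sub>3, c\<^sub>3]),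
       (w [d\<^sub>1, c\<^sub>1], w [c\<^sub>2, d\<^sub>2] [^]\<^bsub>P\<^esub> r),
       (w [c\<^sub>3, d\<^sub>3], w [d\<^sub>2, c\<^sub>2] [^]\<^bsub>P\<^esub> r)})"

definition algebra_C ::
    "nat \<Rightarrow> ('k :: field, ((nat, arrow) quiver_path \<Rightarrow> 'k) set) module" where
  "algebra_C r = (if r = 1 then algebra_A 1 else
     (let P = path_algebra quiver_C; w = path_elt quiver_C in
      quiver_algebra quiver_C
       {(w [a\<^sub>1, b\<^sub>1], \<zero>\<^bsub>P\<^esub>), (w [b\<^sub>2, a\<^sub>2], \<zero>\<^bsub>P\<^esub>), (w [a\<^sub>2, c\<^sub>0], \<zero>\<^bsub>P\<^esub>), (w [c\<^sub>0, b\<^sub>2], \<zero>\<^bsub>P\<^esub>),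
        (w [c\<^sub>0] [^]\<^bsub>P\<^esub> r, w [b\<^sub>2, b\<^sub>1, a\<^sub>1, a\<^sub>2]),
        (w [a\<^sub>2, b\<^sub>2, b\<^sub>1, a\<^sub>1], w [b\<^sub>1, a\<^sub>1, a\<^sub>2, b\<^sub>2])}))"

end

theory Submission
  imports Defs
begin

text \<open>
  Give every arrow a natural number as its weight and every path the sum of the weights of its
  arrows. Weights add up under concatenation, so the path algebra is graded by weight
  (\<open>graded_path_algebra\<close>). If both sides of each relation are homogeneous of the same weight, then
  the ideal of relations is generated by homogeneous elements; hence it contains the components of
  its elements (\<open>proj_genideal\<close>), and the grading descends to the quotient (\<open>quotient_grading\<close>).
  It is positive because weights are natural numbers.

  The induced grading could still be trivial if the arrows of positive weight vanished in the
  quotient. They do not: all relations are combinations of paths of length at least two. Such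
  combinations form an ideal, the square of the arrow ideal, and it contains no arrow.

  Suitable weights are found by solving the linear equations that the relations impose. In
  \<open>A\<^sub>r\<close> the two sides of the only nonmonomial relation have equal length, so every arrow
  gets weight one. In \<open>B\<^sub>r\<close> the weights have to satisfy
  \<open>c\<^sub>1 + d\<^sub>1 = c\<^sub>3 + d\<^sub>3 = r (c\<^sub>2 + d\<^sub>2)\<close>, which \<open>c\<^sub>2 = d\<^sub>2 = 1\<close> and weight \<open>r\<close> for the others
  achieve. In \<open>C\<^sub>r\<close> the equation \<open>r c = b\<^sub>2 + b\<^sub>1 + a\<^sub>1 + a\<^sub>2\<close> is solved by weight \<open>4\<close> for the loop
  and \<open>r\<close> for the others, and the remaining relation compares two orderings of the same arrows.
\<close>

section \<open>Graded algebras and their quotients by homogeneous ideals\<close>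

text \<open>
  The grading is given by its projections instead of its homogeneous subspaces: the component of an
  element is then a term, and stability of an ideal under taking components is a closure property.
\<close>

locale graded_algebra = module "ring_of_type_algebra :: 'k :: field ring" A + ring A
  for A :: "('k :: field, 'a) module" (structure) +
  fixes proj :: "int \<Rightarrow> 'a \<Rightarrow> 'a"
  assumes smult_mult:
      "x \<in> carrier A \<Longrightarrow> y \<in> carrier A \<Longrightarrow> a \<odot>\<^bsub>A\<^esub> (x \<otimes>\<^bsub>A\<^esub> y) = (a \<odot>\<^bsub>A\<^esub> x) \<otimes>\<^bsub>A\<^esub> y"
    and proj_closed [simp]: "x \<in> carrier A \<Longrightarrow> proj i x \<in> carrier A"
    and proj_add: "x \<in> carrier A \<Longrightarrow> y \<in> carrier A \<Longrightarrow> proj i (x \<oplus>\<^bsub>A\<^esub> y) = proj i x \<oplus>\<^bsub>A\<^esub> proj i y"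
    and proj_smult: "x \<in> carrier A \<Longrightarrow> proj i (a \<odot>\<^bsub>A\<^esub> x) = a \<odot>\<^bsub>A\<^esub> proj i x"
    and proj_proj: "x \<in> carrier A \<Longrightarrow> proj i (proj j x) = (if i = j then proj j x else \<zero>\<^bsub>A\<^esub>)"
    and finite_proj: "x \<in> carrier A \<Longrightarrow> finite {i. proj i x \<noteq> \<zero>\<^bsub>A\<^esub>}"
    and sum_proj: "x \<in> carrier A \<Longrightarrow> (\<Oplus>\<^bsub>A\<^esub>i \<in> {i. proj i x \<noteq> \<zero>\<^bsub>A\<^esub>}. proj i x) = x"
    and proj_mult: "x \<in> carrier A \<Longrightarrow> y \<in> carrier A \<Longrightarrow>
      proj (i + j) (proj i x \<otimes>\<^bsub>A\<^esub> proj j y) = proj i x \<otimes>\<^bsub>A\<^esub> proj j y"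
begin

definition homogeneous :: "int \<Rightarrow> 'a set" where
  "homogeneous i = {x \<in> carrier A. proj i x = x}"

lemma smult_in_carrier [simp]: "x \<in> carrier A \<Longrightarrow> a \<odot>\<^bsub>A\<^esub> x \<in> carrier A"
  by (rule smult_closed) (auto simp: ring_of_type_algebra_def)

lemma smult_add: "x \<in> carrier A \<Longrightarrow> y \<in> carrier A \<Longrightarrow>
    a \<odot>\<^bsub>A\<^esub> (x \<oplus>\<^bsub>A\<^esub> y) = a \<odot>\<^bsub>A\<^esub> x \<oplus>\<^bsub>A\<^esub> a \<odot>\<^bsub>A\<^esub> y"
  by (rule smult_r_distr) (auto simp: ring_of_type_algebra_def)

lemma proj_zero [simp]: "proj i \<zero>\<^bsub>A\<^esub> = \<zero>\<^bsub>A\<^esub>"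
proof -
  have "proj i \<zero>\<^bsub>A\<^esub> = proj i \<zero>\<^bsub>A\<^esub> \<oplus>\<^bsub>A\<^esub> proj i \<zero>\<^bsub>A\<^esub>"
    using proj_add[of "\<zero>\<^bsub>A\<^esub>" "\<zero>\<^bsub>A\<^esub>" i] by simp
  then show ?thesis
    by (metis M.add.l_cancel_one' M.zero_closed proj_closed)
qed

lemma proj_a_inv: "x \<in> carrier A \<Longrightarrow> proj i (\<ominus>\<^bsub>A\<^esub> x) = \<ominus>\<^bsub>A\<^esub> proj i x"
  by (metis M.add.inv_closed M.minus_equality M.l_neg proj_add proj_closed proj_zero)

lemma proj_minus: "x \<in> carrier A \<Longrightarrow> y \<in> carrier A \<Longrightarrow>
    proj i (x \<ominus>\<^bsub>A\<^esub> y) = proj i x \<ominus>\<^bsub>A\<^esub> proj i y"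
  by (simp add: a_minus_def proj_add proj_a_inv)

lemma proj_finsum:
  assumes "finite S" "f \<in> S \<rightarrow> carrier A"
  shows "proj i (\<Oplus>\<^bsub>A\<^esub>j \<in> S. f j) = (\<Oplus>\<^bsub>A\<^esub>j \<in> S. proj i (f j))"
  using assms by (induction S) (auto simp: Pi_iff proj_add)

lemma proj_homogeneous: "x \<in> homogeneous j \<Longrightarrow> proj i x = (if i = j then x else \<zero>\<^bsub>A\<^esub>)"
  using proj_proj[of x i j] by (auto simp: homogeneous_def)

lemma subgroup_homogeneous: "subgroup (homogeneous i) (add_monoid A)"
  by (rule M.add.subgroupI)
    (auto simp: homogeneous_def proj_add proj_a_inv intro: exI[of _ "\<zero>\<^bsub>A\<^esub>"])

lemma smult_homogeneous: "x \<in> homogeneous i \<Longrightarrow> a \<odot>\<^bsub>A\<^esub> x \<in> homogeneous i"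
  by (simp add: homogeneous_def proj_smult)

lemma mult_homogeneous:
  "x \<in> homogeneous i \<Longrightarrow> y \<in> homogeneous j \<Longrightarrow> x \<otimes>\<^bsub>A\<^esub> y \<in> homogeneous (i + j)"
  using proj_mult[of x y i j] by (simp add: homogeneous_def)

text \<open>
  A product of homogeneous elements is homogeneous, so it has no component other than itself, and
  this one lies in the ideal if one of the factors does. Expanding both factors of an
  arbitrary product into components reduces the absorption property to this case.
\<close>

lemma components_in_ideal:
  assumes "ideal I A"
  shows "ideal {x \<in> carrier A. \<forall>n. proj n x \<in> I} A"
proof -
  interpret I: ideal I A by fact
  define J where "J = {x \<in> carrier A. \<forall>n. proj n x \<in> I}"
  have add: "subgroup J (add_monoid A)"
    by (rule M.add.subgroupI)
      (auto simp: J_def proj_add proj_a_inv intro: exI[of _ "\<zero>\<^bsub>A\<^esub>"])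
  have sum: "(\<Oplus>\<^bsub>A\<^esub>i \<in> S. f i) \<in> J" if "finite S" "\<And>i. i \<in> S \<Longrightarrow> f i \<in> J" for S :: "int set" and f
    using that
  proof (induction S)
    case empty
    then show ?case using subgroup.one_closed[OF add] by simp
  next
    case (insert i S)
    then have "f \<in> insert i S \<rightarrow> carrier A" by (auto simp: J_def)
    then show ?case using insert subgroup.m_closed[OF add] by (simp add: Pi_iff)
  qed
  have mult: "x \<otimes>\<^bsub>A\<^esub> y \<in> J"
    if xy: "x \<in> carrier A" "y \<in> carrier A" and "x \<in> J \<or> y \<in> J" for x y
  proof -
    let ?X = "{i. proj i x \<noteq> \<zero>\<^bsub>A\<^esub>}" and ?Y = "{i. proj i y \<noteq> \<zero>\<^bsub>A\<^esub>}"
    have "proj i x \<otimes>\<^bsub>A\<^esub> proj j y \<in> J" for i j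
    proof -
      have "proj i x \<otimes>\<^bsub>A\<^esub> proj j y \<in> I"
        using that by (auto simp: J_def I.I_l_closed I.I_r_closed)
      moreover have "proj i x \<otimes>\<^bsub>A\<^esub> proj j y \<in> homogeneous (i + j)"
        using xy by (simp add: homogeneous_def proj_mult)
      ultimately show ?thesis
        using xy by (auto simp: J_def proj_homogeneous)
    qed
    then have "(\<Oplus>\<^bsub>A\<^esub>i \<in> ?X. \<Oplus>\<^bsub>A\<^esub>j \<in> ?Y. proj i x \<otimes>\<^bsub>A\<^esub> proj j y) \<in> J"
      using xy by (intro sum finite_proj)
    also have "(\<Oplus>\<^bsub>A\<^esub>i \<in> ?X. \<Oplus>\<^bsub>A\<^esub>j \<in> ?Y. proj i x \<otimes>\<^bsub>A\<^esub> proj j y) = (\<Oplus>\<^bsub>A\<^esub>i \<in> ?X. proj i x \<otimes>\<^bsub>A\<^esub> y)"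
      using xy by (intro M.finsum_cong') (auto simp: finsum_rdistr[symmetric] finite_proj sum_proj)
    also have "\<dots> = x \<otimes>\<^bsub>A\<^esub> y"
      using xy by (subst finsum_ldistr[symmetric]) (auto simp: finite_proj sum_proj)
    finally show ?thesis .
  qed
  have "ideal J A"
    by (rule idealI) (use add mult in \<open>auto simp: J_def ring_axioms\<close>)
  then show ?thesis by (simp add: J_def)
qed

text \<open>
  The elements all of whose components lie in the generated ideal form an ideal that contains the
  generators, hence contains the generated ideal.
\<close>

lemma proj_genideal:
  assumes gen: "\<And>s. s \<in> S \<Longrightarrow> \<exists>i. s \<in> homogeneous i" and x: "x \<in> genideal A S"
  shows "proj n x \<in> genideal A S"
proof -
  have S: "S \<subseteq> carrier A"
    using gen by (auto simp: homogeneous_def)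
  interpret I: ideal "genideal A S" A
    using S by (rule genideal_ideal)
  have "s \<in> {x \<in> carrier A. \<forall>n. proj n x \<in> genideal A S}" if "s \<in> S" for s
    using gen[OF that] that S genideal_self[OF S] by (auto simp: proj_homogeneous)
  then have "genideal A S \<subseteq> {x \<in> carrier A. \<forall>n. proj n x \<in> genideal A S}"
    by (intro genideal_minimal components_in_ideal I.ideal_axioms subsetI)
  then show ?thesis using x by auto
qed

end

lemma ring_quotient_algebra:
  assumes "ideal I A" shows "ring_hom_ring A (quotient_algebra A I) ((+>\<^bsub>A\<^esub>) I)"
proof -
  interpret ideal I A by fact
  interpret Quot: ring "A Quot I"
    by (rule quotient_is_ring)
  have [simp]: "carrier (quotient_algebra A I) = carrier (A Quot I)"
      "\<zero>\<^bsub>quotient_algebra A I\<^esub> = \<zero>\<^bsub>A Quot I\<^esub>" "\<one>\<^bsub>quotient_algebra A I\<^esub> = \<one>\<^bsub>A Quot I\<^esub>"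
      "add (quotient_algebra A I) = add (A Quot I)"
      "monoid.mult (quotient_algebra A I) = monoid.mult (A Quot I)"
    by (simp_all add: quotient_algebra_def ring.extend_def FactRing_def)
  have "ring (quotient_algebra A I)"
  proof (rule ringI)
    show "abelian_group (quotient_algebra A I)"
      by (rule abelian_groupI) (auto simp: Quot.a_ac intro!: bexI[of _ "\<ominus>\<^bsub>A Quot I\<^esub> x" for x] Quot.l_neg)
    show "Group.monoid (quotient_algebra A I)"
      by (rule monoidI) (auto simp: Quot.m_assoc)
  qed (auto simp: Quot.l_distr Quot.r_distr)
  moreover have "(+>\<^bsub>A\<^esub>) I \<in> ring_hom A (quotient_algebra A I)"
    using rcos_ring_hom by (simp add: ring_hom_def)
  ultimately show ?thesis
    by (intro ring_hom_ringI2 ring_axioms)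
qed

context graded_algebra
begin

text \<open>
  Scaling by \<open>a\<close> agrees with multiplication by the ring element \<open>a \<odot> \<one>\<close>, so a two-sided
  ideal is closed under it; this makes the union in the definition of the quotient a single coset.
\<close>

lemma smult_coset:
  assumes "ideal I A" "x \<in> carrier A"
  shows "a \<odot>\<^bsub>quotient_algebra A I\<^esub> (I +>\<^bsub>A\<^esub> x) = I +>\<^bsub>A\<^esub> (a \<odot>\<^bsub>A\<^esub> x)"
proof -
  interpret I: ideal I A by fact
  have "I +>\<^bsub>A\<^esub> (a \<odot>\<^bsub>A\<^esub> y) = I +>\<^bsub>A\<^esub> (a \<odot>\<^bsub>A\<^esub> x)" if y: "y \<in> I +>\<^bsub>A\<^esub> x" for y
  proof -
    obtain z where z: "z \<in> I" "y = z \<oplus>\<^bsub>A\<^esub> x"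
      using y by (auto simp: a_r_coset_def')
    have "a \<odot>\<^bsub>A\<^esub> z = (a \<odot>\<^bsub>A\<^esub> \<one>\<^bsub>A\<^esub>) \<otimes>\<^bsub>A\<^esub> z"
      using z I.a_Hcarr by (simp flip: smult_mult)
    then have "a \<odot>\<^bsub>A\<^esub> z \<in> I"
      using z I.I_l_closed by simp
    moreover have "a \<odot>\<^bsub>A\<^esub> y = a \<odot>\<^bsub>A\<^esub> z \<oplus>\<^bsub>A\<^esub> a \<odot>\<^bsub>A\<^esub> x"
      using z assms I.a_Hcarr by (simp add: smult_add)
    ultimately have "a \<odot>\<^bsub>A\<^esub> y \<in> I +>\<^bsub>A\<^esub> (a \<odot>\<^bsub>A\<^esub> x)"
      by (auto simp: a_r_coset_def')
    then show ?thesis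
      using assms by (intro I.a_repr_independence'[symmetric]) auto
  qed
  moreover have "x \<in> I +>\<^bsub>A\<^esub> x"
    using assms I.a_rcos_self by simp
  ultimately have "(\<Union>y \<in> I +>\<^bsub>A\<^esub> x. I +>\<^bsub>A\<^esub> (a \<odot>\<^bsub>A\<^esub> y)) = I +>\<^bsub>A\<^esub> (a \<odot>\<^bsub>A\<^esub> x)"
    by (intro UN_constant_eq[of x] ballI)
  then show ?thesis
    by (simp add: quotient_algebra_def ring.extend_def module.fields_def)
qed

text \<open>
  Existence of a decomposition comes from decomposing a representative. For uniqueness, two
  decompositions lift to elements of \<open>A\<close> that differ by an element of \<open>I\<close>; as \<open>I\<close> contains
  the components of this difference, the lifts agree modulo \<open>I\<close> in each degree.
\<close>

theorem quotient_grading: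
  assumes I: "ideal I A" and proj_I: "\<And>n x. x \<in> I \<Longrightarrow> proj n x \<in> I"
  shows "is_grading (quotient_algebra A I) (\<lambda>i. (+>\<^bsub>A\<^esub>) I ` homogeneous i)"
proof -
  let ?Q = "quotient_algebra A I" and ?\<pi> = "(+>\<^bsub>A\<^esub>) I"
  interpret I: ideal I A by fact
  interpret \<pi>: ring_hom_ring A ?Q ?\<pi>
    using I by (rule ring_quotient_algebra)
  have carr: "carrier ?Q = ?\<pi> ` carrier A"
    unfolding quotient_algebra_def ring.extend_def FactRing_def A_RCOSETS_def' by auto
  have eq_iff: "?\<pi> x = ?\<pi> y \<longleftrightarrow> x \<ominus>\<^bsub>A\<^esub> y \<in> I" if "x \<in> carrier A" "y \<in> carrier A" for x y
    using quotient_eq_iff_same_a_r_cos[OF I that] by blast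
  have eq_proj: "?\<pi> (proj i x) = ?\<pi> (proj i y)"
    if "?\<pi> x = ?\<pi> y" "x \<in> carrier A" "y \<in> carrier A" for x y i
    using that proj_I[of "x \<ominus>\<^bsub>A\<^esub> y" i] by (simp add: eq_iff proj_minus)
  have submod: "submodule (?\<pi> ` homogeneous i) (ring_of_type_algebra :: 'k ring) ?Q" for i
  proof -
    have "?\<pi> \<in> hom (add_monoid A) (add_monoid ?Q)"
      by (auto simp: hom_def)
    then have "group_hom (add_monoid A) (add_monoid ?Q) ?\<pi>"
      using M.a_group \<pi>.S.a_group by (simp add: group_hom_def group_hom_axioms_def)
    then have "subgroup (?\<pi> ` homogeneous i) (add_monoid ?Q)"
      using subgroup_homogeneous by (rule group_hom.subgroup_img_is_subgroup)
    moreover have "a \<odot>\<^bsub>?Q\<^esub> U \<in> ?\<pi> ` homogeneous i" if "U \<in> ?\<pi> ` homogeneous i" for a U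
      using that smult_coset[OF I] smult_homogeneous by (auto simp: homogeneous_def)
    ultimately show ?thesis
      by (simp add: submodule_def submodule_axioms_def)
  qed
  have decomp: "\<exists>!f. (\<forall>i. f i \<in> ?\<pi> ` homogeneous i) \<and> finite {i. f i \<noteq> \<zero>\<^bsub>?Q\<^esub>} \<and>
        U = (\<Oplus>\<^bsub>?Q\<^esub>i \<in> {i. f i \<noteq> \<zero>\<^bsub>?Q\<^esub>}. f i)" if U_carr: "U \<in> carrier ?Q" for U
  proof -
    obtain x where x: "x \<in> carrier A" and U: "U = ?\<pi> x"
      using U_carr carr by auto
    show ?thesis
    proof (rule ex1I[of _ "\<lambda>i. ?\<pi> (proj i x)"])
      let ?S = "{i. proj i x \<noteq> \<zero>\<^bsub>A\<^esub>}" and ?T = "{i. ?\<pi> (proj i x) \<noteq> \<zero>\<^bsub>?Q\<^esub>}"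
      have T: "?T \<subseteq> ?S"
        by auto
      have "U = ?\<pi> (\<Oplus>\<^bsub>A\<^esub>i \<in> ?S. proj i x)"
        using x U by (simp add: sum_proj)
      also have "\<dots> = (\<Oplus>\<^bsub>?Q\<^esub>i \<in> ?S. ?\<pi> (proj i x))"
        using x \<pi>.hom_finsum[of "\<lambda>i. proj i x" ?S] by (simp add: o_def)
      also have "\<dots> = (\<Oplus>\<^bsub>?Q\<^esub>i \<in> ?T. ?\<pi> (proj i x))"
        using x T by (intro \<pi>.S.add.finprod_mono_neutral_cong_right finite_proj) auto
      finally have "U = (\<Oplus>\<^bsub>?Q\<^esub>i \<in> ?T. ?\<pi> (proj i x))" .
      moreover have "finite ?T"
        using finite_subset[OF T finite_proj[OF x]] .
      moreover have "?\<pi> (proj i x) \<in> ?\<pi> ` homogeneous i" for i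
        using x by (auto simp: homogeneous_def proj_proj)
      ultimately show "(\<forall>i. ?\<pi> (proj i x) \<in> ?\<pi> ` homogeneous i) \<and> finite ?T \<and>
          U = (\<Oplus>\<^bsub>?Q\<^esub>i \<in> ?T. ?\<pi> (proj i x))"
        by (intro conjI allI)
    next
      fix f
      assume f: "(\<forall>i. f i \<in> ?\<pi> ` homogeneous i) \<and> finite {i. f i \<noteq> \<zero>\<^bsub>?Q\<^esub>} \<and>
        U = (\<Oplus>\<^bsub>?Q\<^esub>i \<in> {i. f i \<noteq> \<zero>\<^bsub>?Q\<^esub>}. f i)"
      let ?T = "{i. f i \<noteq> \<zero>\<^bsub>?Q\<^esub>}"
      \<comment> \<open>Lift the given decomposition to homogeneous elements and compare their sum \<open>y\<close> with \<open>x\<close>.\<close>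
      have "\<forall>i. \<exists>z. z \<in> homogeneous i \<and> f i = ?\<pi> z"
        using f by blast
      from choice[OF this] obtain h
        where h: "\<And>i. h i \<in> homogeneous i" and fh: "\<And>i. f i = ?\<pi> (h i)"
        by blast
      have h_carr: "h i \<in> carrier A" for i
        using h by (auto simp: homogeneous_def)
      define y where "y = (\<Oplus>\<^bsub>A\<^esub>i \<in> ?T. h i)"
      have y: "y \<in> carrier A"
        using h_carr by (auto simp: y_def)
      have "U = ?\<pi> y"
        using f h_carr \<pi>.hom_finsum[of h ?T] by (simp add: y_def fh o_def)
      then have \<pi>_proj: "?\<pi> (proj i y) = ?\<pi> (proj i x)" for i
        using x y U by (intro eq_proj) auto
      have "f i = ?\<pi> (proj i y)" for i
      proof -
        have "proj i y = (\<Oplus>\<^bsub>A\<^esub>j \<in> ?T. if i = j then h j else \<zero>\<^bsub>A\<^esub>)"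
          using f h_carr by (simp add: y_def proj_finsum proj_homogeneous[OF h])
        also have "\<dots> = (if i \<in> ?T then h i else \<zero>\<^bsub>A\<^esub>)"
          using f h_carr M.add.finprod_singleton[of i ?T h]
          by (cases "i \<in> ?T") (auto intro!: M.add.finprod_one_eqI split: if_splits)
        finally show ?thesis
          by (auto simp: fh)
      qed
      then show "f = (\<lambda>i. ?\<pi> (proj i x))"
        using \<pi>_proj by auto
    qed
  qed
  have mult: "U \<otimes>\<^bsub>?Q\<^esub> V \<in> ?\<pi> ` homogeneous (i + j)"
    if UV: "U \<in> ?\<pi> ` homogeneous i" "V \<in> ?\<pi> ` homogeneous j" for U V i j
  proof -
    obtain x y where xy: "x \<in> homogeneous i" "U = ?\<pi> x" "y \<in> homogeneous j" "V = ?\<pi> y"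
      using UV by blast
    then have "U \<otimes>\<^bsub>?Q\<^esub> V = ?\<pi> (x \<otimes>\<^bsub>A\<^esub> y)"
      by (simp add: homogeneous_def)
    then show ?thesis
      using xy mult_homogeneous by blast
  qed
  show ?thesis
    unfolding is_grading_def by (intro conjI allI ballI submod decomp mult)
qed

end

section \<open>Path algebras\<close>

definition splittings ::
    "('v, 'e) pre_digraph \<Rightarrow> 'v \<Rightarrow> 'e list \<Rightarrow> 'v \<Rightarrow> ('e list \<times> 'v \<times> 'e list) set" where
  "splittings Q u p v = {(p1, w, p2). p1 @ p2 = p \<and> (u, p1, w) \<in> quiver_paths Q \<and> (w, p2, v) \<in> quiver_paths Q}"

lemma path_algebra_carrier: "f \<in> carrier (path_algebra Q) \<longleftrightarrow>
    finite {x. f x \<noteq> 0} \<and> (\<forall>x. f x \<noteq> 0 \<longrightarrow> x \<in> quiver_paths Q)"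
  by (auto simp: path_algebra_def)

lemma path_algebra_mult: "(f \<otimes>\<^bsub>path_algebra Q\<^esub> g) (u, p, v) =
    (\<Sum>(p1, w, p2) \<in> splittings Q u p v. f (u, p1, w) * g (w, p2, v))"
  by (simp add: path_algebra_def splittings_def)

lemma path_algebra_apply:
  "\<one>\<^bsub>path_algebra Q\<^esub> x = (if \<exists>u \<in> verts Q. x = (u, [], u) then 1 else 0)"
  "\<zero>\<^bsub>path_algebra Q\<^esub> x = 0"
  "(f \<oplus>\<^bsub>path_algebra Q\<^esub> g) x = f x + g x"
  "(a \<odot>\<^bsub>path_algebra Q\<^esub> f) x = a * f x"
  by (simp_all add: path_algebra_def)

lemma mult_nonzero_splits:
  assumes "(f \<otimes>\<^bsub>path_algebra Q\<^esub> g) (u, p, v) \<noteq> 0"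
  obtains p1 w p2 where "(p1, w, p2) \<in> splittings Q u p v" "f (u, p1, w) \<noteq> 0" "g (w, p2, v) \<noteq> 0"
proof -
  obtain s where "s \<in> splittings Q u p v" "(case s of (p1, w, p2) \<Rightarrow> f (u, p1, w) * g (w, p2, v)) \<noteq> 0"
    using assms unfolding path_algebra_mult by (rule sum.not_neutral_contains_not_neutral)
  then show thesis
    using that by (cases s) auto
qed

context wf_digraph
begin

text \<open>
  The middle vertex of a splitting is determined by its first part, so that a splitting amounts to
  a position in the list of arrows.
\<close>

lemma finite_splittings: "finite (splittings G u p v)"
proof (rule finite_subset)
  show "splittings G u p v \<subseteq> (\<lambda>n. (take n p, awlast u (take n p), drop n p)) ` {..length p}"
  proof
    fix s assume "s \<in> splittings G u p v"
    then obtain p1 w p2 where "s = (p1, w, p2)" "p = p1 @ p2" "awalk u p1 w"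
      by (auto simp: splittings_def quiver_paths_def)
    then show "s \<in> (\<lambda>n. (take n p, awlast u (take n p), drop n p)) ` {..length p}"
      by (intro image_eqI[of _ _ "length p1"]) auto
  qed
qed simp

lemma quiver_paths_append: "(u, p1, w) \<in> quiver_paths G \<Longrightarrow> (w, p2, v) \<in> quiver_paths G \<Longrightarrow>
    (u, p1 @ p2, v) \<in> quiver_paths G"
  by (auto simp: quiver_paths_def)

lemma splittings_path: "s \<in> splittings G u p v \<Longrightarrow> (u, p, v) \<in> quiver_paths G"
  by (auto simp: splittings_def quiver_paths_append)

lemma path_algebra_mult_closed:
  fixes f g :: "('a, 'b) quiver_path \<Rightarrow> 'k :: field"
  assumes "f \<in> carrier (path_algebra G)" "g \<in> carrier (path_algebra G)"
  shows "f \<otimes>\<^bsub>path_algebra G\<^esub> g \<in> carrier (path_algebra G)"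
proof -
  let ?fg = "f \<otimes>\<^bsub>path_algebra G\<^esub> g"
  have "{x. ?fg x \<noteq> 0} \<subseteq> (\<lambda>((u, p1, w), (w', p2, v)). (u, p1 @ p2, v)) ` ({x. f x \<noteq> 0} \<times> {x. g x \<noteq> 0})"
    by (force elim!: mult_nonzero_splits simp: splittings_def)
  then have "finite {x. ?fg x \<noteq> 0}"
    by (rule finite_subset) (use assms in \<open>auto simp: path_algebra_carrier\<close>)
  moreover have "x \<in> quiver_paths G" if "?fg x \<noteq> 0" for x
    using that splittings_path by (cases x) (auto elim!: mult_nonzero_splits)
  ultimately show ?thesis
    by (simp add: path_algebra_carrier)
qed

lemma path_algebra_assoc:
  fixes f g h :: "('a, 'b) quiver_path \<Rightarrow> 'k :: field"
  shows "f \<otimes>\<^bsub>path_algebra G\<^esub> g \<otimes>\<^bsub>path_algebra G\<^esub> h = f \<otimes>\<^bsub>path_algebra G\<^esub> (g \<otimes>\<^bsub>path_algebra G\<^esub> h)"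
proof
  fix x :: "('a, 'b) quiver_path"
  obtain u p v where x: "x = (u, p, v)"
    by (cases x)
  let ?S = "splittings G"
  have "(f \<otimes>\<^bsub>path_algebra G\<^esub> g \<otimes>\<^bsub>path_algebra G\<^esub> h) x =
    (\<Sum>s \<in> ?S u p v. \<Sum>t \<in> ?S u (fst s) (fst (snd s)).
      f (u, fst t, fst (snd t)) * g (fst (snd t), snd (snd t), fst (snd s)) * h (fst (snd s), snd (snd s), v))"
    by (simp add: x path_algebra_mult sum_distrib_right case_prod_unfold)
  also have "\<dots> = (\<Sum>(s, t) \<in> Sigma (?S u p v) (\<lambda>s. ?S u (fst s) (fst (snd s))).
      f (u, fst t, fst (snd t)) * g (fst (snd t), snd (snd t), fst (snd s)) * h (fst (snd s), snd (snd s), v))"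
    by (intro sum.Sigma) (auto simp: finite_splittings)
  \<comment> \<open>Both sides run over the ways to cut the path in three; only the order of the cuts differs.\<close>
  also have "\<dots> = (\<Sum>(s, t) \<in> Sigma (?S u p v) (\<lambda>s. ?S (fst (snd s)) (snd (snd s)) v).
      f (u, fst s, fst (snd s)) * (g (fst (snd s), fst t, fst (snd t)) * h (fst (snd t), snd (snd t), v)))"
    by (rule sum.reindex_bij_witness[where
          i = "\<lambda>((p1, w1, q), (p2, w2, p3)). ((p1 @ p2, w2, p3), (p1, w1, p2))" and
          j = "\<lambda>((q, w2, p3), (p1, w1, p2)). ((p1, w1, p2 @ p3), (p2, w2, p3))"])
      (auto simp: splittings_def intro: quiver_paths_append)
  also have "\<dots> = (\<Sum>s \<in> ?S u p v. \<Sum>t \<in> ?S (fst (snd s)) (snd (snd s)) v.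
      f (u, fst s, fst (snd s)) * (g (fst (snd s), fst t, fst (snd t)) * h (fst (snd t), snd (snd t), v)))"
    by (intro sum.Sigma[symmetric]) (auto simp: finite_splittings)
  also have "\<dots> = (f \<otimes>\<^bsub>path_algebra G\<^esub> (g \<otimes>\<^bsub>path_algebra G\<^esub> h)) x"
    by (simp add: x path_algebra_mult sum_distrib_left case_prod_unfold)
  finally show "(f \<otimes>\<^bsub>path_algebra G\<^esub> g \<otimes>\<^bsub>path_algebra G\<^esub> h) x = (f \<otimes>\<^bsub>path_algebra G\<^esub> (g \<otimes>\<^bsub>path_algebra G\<^esub> h)) x" .
qed

lemma path_algebra_one_left:
  fixes f :: "('a, 'b) quiver_path \<Rightarrow> 'k :: field"
  assumes f: "f \<in> carrier (path_algebra G)"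
  shows "\<one>\<^bsub>path_algebra G\<^esub> \<otimes>\<^bsub>path_algebra G\<^esub> f = f"
proof
  fix x :: "('a, 'b) quiver_path"
  obtain u p v where x: "x = (u, p, v)"
    by (cases x)
  show "(\<one>\<^bsub>path_algebra G\<^esub> \<otimes>\<^bsub>path_algebra G\<^esub> f) x = f x"
  proof (cases "x \<in> quiver_paths G")
    case True
    then have "u \<in> verts G" "([], u, p) \<in> splittings G u p v"
      by (auto simp: x splittings_def quiver_paths_def awalk_def)
    then have "(\<one>\<^bsub>path_algebra G\<^esub> \<otimes>\<^bsub>path_algebra G\<^esub> f) x =
        (\<Sum>(p1, w, p2) \<in> {([], u, p)}. \<one>\<^bsub>path_algebra G\<^esub> (u, p1, w) * f (w, p2, v))"
      unfolding x path_algebra_mult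
      by (intro sum.mono_neutral_right finite_splittings)
        (auto simp: path_algebra_apply splittings_def split: if_splits)
    then show ?thesis
      using \<open>u \<in> verts G\<close> by (simp add: x path_algebra_apply)
  next
    case False
    then have "splittings G u p v = {}"
      unfolding x using splittings_path by fast
    moreover have "f x = 0"
      using False f unfolding path_algebra_carrier by blast
    ultimately show ?thesis
      by (simp add: x path_algebra_mult)
  qed
qed

lemma path_algebra_one_right:
  fixes f :: "('a, 'b) quiver_path \<Rightarrow> 'k :: field"
  assumes f: "f \<in> carrier (path_algebra G)"
  shows "f \<otimes>\<^bsub>path_algebra G\<^esub> \<one>\<^bsub>path_algebra G\<^esub> = f"
proof
  fix x :: "('a, 'b) quiver_path"
  obtain u p v where x: "x = (u, p, v)"
    by (cases x)
  show "(f \<otimes>\<^bsub>path_algebra G\<^esub> \<one>\<^bsub>path_algebra G\<^esub>) x = f x"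
  proof (cases "x \<in> quiver_paths G")
    case True
    then have "v \<in> verts G" "(p, v, []) \<in> splittings G u p v"
      using awalk_last_in_verts by (auto simp: x splittings_def quiver_paths_def awalk_Nil_iff)
    then have "(f \<otimes>\<^bsub>path_algebra G\<^esub> \<one>\<^bsub>path_algebra G\<^esub>) x =
        (\<Sum>(p1, w, p2) \<in> {(p, v, [])}. f (u, p1, w) * \<one>\<^bsub>path_algebra G\<^esub> (w, p2, v))"
      unfolding x path_algebra_mult
      by (intro sum.mono_neutral_right finite_splittings)
        (auto simp: path_algebra_apply splittings_def split: if_splits)
    then show ?thesis
      using \<open>v \<in> verts G\<close> by (simp add: x path_algebra_apply)
  next
    case False
    then have "splittings G u p v = {}"
      unfolding x using splittings_path by fast
    moreover have "f x = 0"
      using False f unfolding path_algebra_carrier by blast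
    ultimately show ?thesis
      by (simp add: x path_algebra_mult)
  qed
qed

end

context fin_digraph
begin

lemma abelian_group_path_algebra:
  "abelian_group (path_algebra G :: ('k :: field, ('a, 'b) quiver_path \<Rightarrow> 'k) module)"
    (is "abelian_group ?P")
proof (rule abelian_groupI)
  fix f g :: "('a, 'b) quiver_path \<Rightarrow> 'k"
  assume f: "f \<in> carrier ?P" and g: "g \<in> carrier ?P"
  have "{x. f x + g x \<noteq> 0} \<subseteq> {x. f x \<noteq> 0} \<union> {x. g x \<noteq> 0}"
    by auto
  then have "finite {x. f x + g x \<noteq> 0}"
    using f g by (auto simp: path_algebra_carrier intro: finite_subset)
  then show "f \<oplus>\<^bsub>?P\<^esub> g \<in> carrier ?P"
    using f g by (auto simp: path_algebra_carrier path_algebra_apply) (metis add_0)+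
  show "\<exists>g \<in> carrier ?P. g \<oplus>\<^bsub>?P\<^esub> f = \<zero>\<^bsub>?P\<^esub>"
    using f by (intro bexI[of _ "\<lambda>x. - f x"]) (auto simp: path_algebra_carrier path_algebra_apply fun_eq_iff)
qed (auto simp: path_algebra_carrier path_algebra_apply fun_eq_iff)

lemma ring_path_algebra:
  "ring (path_algebra G :: ('k :: field, ('a, 'b) quiver_path \<Rightarrow> 'k) module)" (is "ring ?P")
proof (rule ringI)
  show "abelian_group ?P"
    by (rule abelian_group_path_algebra)
  show "Group.monoid ?P"
  proof (rule monoidI)
    have "{x. \<exists>u \<in> verts G. x = (u, [], u)} = (\<lambda>u. (u, [], u)) ` verts G"
      by auto
    then show "\<one>\<^bsub>?P\<^esub> \<in> carrier ?P"
      by (auto simp: path_algebra_carrier path_algebra_apply quiver_paths_def awalk_Nil_iff)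
  qed (simp_all add: path_algebra_mult_closed path_algebra_assoc path_algebra_one_left path_algebra_one_right)
  fix f g h :: "('a, 'b) quiver_path \<Rightarrow> 'k"
  show "(f \<oplus>\<^bsub>?P\<^esub> g) \<otimes>\<^bsub>?P\<^esub> h = f \<otimes>\<^bsub>?P\<^esub> h \<oplus>\<^bsub>?P\<^esub> g \<otimes>\<^bsub>?P\<^esub> h"
    by (rule ext) (clarsimp simp: path_algebra_mult path_algebra_apply distrib_right case_prod_unfold sum.distrib)
  show "h \<otimes>\<^bsub>?P\<^esub> (f \<oplus>\<^bsub>?P\<^esub> g) = h \<otimes>\<^bsub>?P\<^esub> f \<oplus>\<^bsub>?P\<^esub> h \<otimes>\<^bsub>?P\<^esub> g"
    by (rule ext) (clarsimp simp: path_algebra_mult path_algebra_apply distrib_left case_prod_unfold sum.distrib)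
qed

lemma module_path_algebra:
  "module (ring_of_type_algebra :: 'k :: field ring)
    (path_algebra G :: ('k, ('a, 'b) quiver_path \<Rightarrow> 'k) module)" (is "module _ ?P")
proof (rule moduleI)
  show "cring (ring_of_type_algebra :: 'k ring)"
    by (rule cring_from_type_algebra)
  show "abelian_group ?P"
    by (rule abelian_group_path_algebra)
  fix a :: 'k and f :: "('a, 'b) quiver_path \<Rightarrow> 'k"
  assume "f \<in> carrier ?P"
  then show "a \<odot>\<^bsub>?P\<^esub> f \<in> carrier ?P"
    by (cases "a = 0") (auto simp: path_algebra_carrier path_algebra_apply)
qed (auto simp: path_algebra_apply ring_of_type_algebra_def fun_eq_iff algebra_simps)

lemma finsum_path_algebra:
  fixes F :: "'i \<Rightarrow> ('a, 'b) quiver_path \<Rightarrow> 'k :: field"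
  assumes "finite S" "F \<in> S \<rightarrow> carrier (path_algebra G)"
  shows "(\<Oplus>\<^bsub>path_algebra G\<^esub>i \<in> S. F i) x = (\<Sum>i \<in> S. F i x)"
proof -
  interpret abelian_group "path_algebra G :: ('k, ('a, 'b) quiver_path \<Rightarrow> 'k) module"
    by (rule abelian_group_path_algebra)
  show ?thesis
    using assms by (induction S) (auto simp: path_algebra_apply Pi_iff)
qed

end

definition path_weight :: "('e \<Rightarrow> nat) \<Rightarrow> ('v, 'e) quiver_path \<Rightarrow> int" where
  "path_weight w x = int (sum_list (map w (fst (snd x))))"

definition weight_part ::
    "('e \<Rightarrow> nat) \<Rightarrow> int \<Rightarrow> (('v, 'e) quiver_path \<Rightarrow> 'k :: field) \<Rightarrow> ('v, 'e) quiver_path \<Rightarrow> 'k" where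
  "weight_part w i f = (\<lambda>x. if path_weight w x = i then f x else 0)"

lemma (in fin_digraph) graded_path_algebra:
  "graded_algebra (path_algebra G :: ('k :: field, ('a, 'b) quiver_path \<Rightarrow> 'k) module) (weight_part w)"
    (is "graded_algebra ?P _")
proof (intro graded_algebra.intro graded_algebra_axioms.intro module_path_algebra ring_path_algebra)
  fix a :: 'k and i j :: int and f g :: "('a, 'b) quiver_path \<Rightarrow> 'k"
  assume f: "f \<in> carrier ?P"
  have finite_f: "finite {x. f x \<noteq> 0}"
    using f by (simp add: path_algebra_carrier)
  show part_closed: "weight_part w i f \<in> carrier ?P" for i
    using f finite_f by (auto simp: path_algebra_carrier weight_part_def intro: rev_finite_subset)
  show "a \<odot>\<^bsub>?P\<^esub> (f \<otimes>\<^bsub>?P\<^esub> g) = (a \<odot>\<^bsub>?P\<^esub> f) \<otimes>\<^bsub>?P\<^esub> g"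
    by (rule ext) (clarsimp simp: path_algebra_mult path_algebra_apply sum_distrib_left case_prod_unfold mult.assoc)
  show "weight_part w i (f \<oplus>\<^bsub>?P\<^esub> g) = weight_part w i f \<oplus>\<^bsub>?P\<^esub> weight_part w i g"
    "weight_part w i (a \<odot>\<^bsub>?P\<^esub> f) = a \<odot>\<^bsub>?P\<^esub> weight_part w i f"
    "weight_part w i (weight_part w j f) = (if i = j then weight_part w j f else \<zero>\<^bsub>?P\<^esub>)"
    by (auto simp: weight_part_def path_algebra_apply fun_eq_iff)
  let ?S = "{i. weight_part w i f \<noteq> \<zero>\<^bsub>?P\<^esub>}"
  have "?S \<subseteq> path_weight w ` {x. f x \<noteq> 0}"
    by (auto simp: weight_part_def path_algebra_apply fun_eq_iff split: if_splits)
  then show finite_S: "finite ?S"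
    by (rule finite_subset) (use finite_f in simp)
  show "(\<Oplus>\<^bsub>?P\<^esub>i \<in> ?S. weight_part w i f) = f"
  proof
    fix x
    have "f x = 0" if "path_weight w x \<notin> ?S"
    proof -
      have "weight_part w (path_weight w x) f x = 0"
        using that by (simp add: path_algebra_apply)
      then show ?thesis
        by (simp add: weight_part_def)
    qed
    then have "(\<Sum>i \<in> ?S. weight_part w i f x) = f x"
      using finite_S by (auto simp: weight_part_def)
    then show "(\<Oplus>\<^bsub>?P\<^esub>i \<in> ?S. weight_part w i f) x = f x"
      using finite_S part_closed by (subst finsum_path_algebra) auto
  qed
  show "weight_part w (i + j) (weight_part w i f \<otimes>\<^bsub>?P\<^esub> weight_part w j g) =
      weight_part w i f \<otimes>\<^bsub>?P\<^esub> weight_part w j g" (is "weight_part w _ ?h = ?h")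
  proof
    fix x
    have "path_weight w x = i + j" if "?h x \<noteq> 0"
      using that by (cases x)
        (auto elim!: mult_nonzero_splits simp: weight_part_def splittings_def path_weight_def split: if_splits)
    then show "weight_part w (i + j) ?h x = ?h x"
      by (auto simp: weight_part_def[of _ _ ?h])
  qed
qed


definition weight_space ::
    "('v, 'e) pre_digraph \<Rightarrow> ('e \<Rightarrow> nat) \<Rightarrow> int \<Rightarrow> (('v, 'e) quiver_path \<Rightarrow> 'k :: field) set" where
  "weight_space Q w i = {f \<in> carrier (path_algebra Q). \<forall>x. f x \<noteq> 0 \<longrightarrow> path_weight w x = i}"

definition arrow_ideal_squared :: "('v, 'e) pre_digraph \<Rightarrow> (('v, 'e) quiver_path \<Rightarrow> 'k :: field) set" where
  "arrow_ideal_squared Q = {f \<in> carrier (path_algebra Q). \<forall>x. f x \<noteq> 0 \<longrightarrow> 2 \<le> length (fst (snd x))}"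

text \<open>
  With weight one for every arrow, the weight of a path is its length.
\<close>

lemma weight_space_length: "2 \<le> i \<Longrightarrow> f \<in> weight_space Q (\<lambda>_. 1) i \<Longrightarrow> f \<in> arrow_ideal_squared Q"
  by (force simp: weight_space_def arrow_ideal_squared_def path_weight_def sum_list_triv)

text \<open>
  On these lists \<^const>\<open>path_elt\<close> yields an element of the path algebra, with support the path along
  these arrows.
\<close>

definition arrow_sequence :: "('v, 'e) pre_digraph \<Rightarrow> 'e list \<Rightarrow> bool" where
  "arrow_sequence Q es \<longleftrightarrow> es \<noteq> [] \<and> pre_digraph.awalk Q (tail Q (hd es)) es (head Q (last es))"

context fin_digraph
begin

lemma homogeneous_weight_part:
  "graded_algebra.homogeneous (path_algebra G) (weight_part w) i = weight_space G w i"
  by (auto simp: graded_algebra.homogeneous_def[OF graded_path_algebra] weight_space_def weight_part_def fun_eq_iff)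

lemma ideal_arrow_ideal_squared:
  "ideal (arrow_ideal_squared G) (path_algebra G :: ('k :: field, ('a, 'b) quiver_path \<Rightarrow> 'k) module)"
    (is "ideal ?J ?P")
proof (rule idealI)
  interpret ring ?P
    by (rule ring_path_algebra)
  show "ring ?P" ..
  show "subgroup ?J (add_monoid ?P)"
  proof (rule add.subgroupI)
    fix f assume f: "f \<in> ?J"
    have "(\<lambda>x. - f x) \<oplus>\<^bsub>?P\<^esub> f = \<zero>\<^bsub>?P\<^esub>"
      by (simp add: path_algebra_apply fun_eq_iff)
    moreover have "(\<lambda>x. - f x) \<in> ?J"
      using f by (auto simp: arrow_ideal_squared_def path_algebra_carrier)
    ultimately show "\<ominus>\<^bsub>?P\<^esub> f \<in> ?J"
      using f minus_equality[of "\<lambda>x. - f x" f] by (auto simp: arrow_ideal_squared_def)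
  next
    fix f g assume f: "f \<in> ?J" and g: "g \<in> ?J"
    then show "f \<oplus>\<^bsub>?P\<^esub> g \<in> ?J"
      using f g by (auto simp: arrow_ideal_squared_def path_algebra_apply) (metis add_0)
  qed (auto simp: arrow_ideal_squared_def path_algebra_apply intro: exI[of _ "\<zero>\<^bsub>?P\<^esub>"])
  fix f g
  assume f: "f \<in> ?J" and g: "g \<in> carrier ?P"
  then show "g \<otimes>\<^bsub>?P\<^esub> f \<in> ?J" "f \<otimes>\<^bsub>?P\<^esub> g \<in> ?J"
    by (fastforce simp: arrow_ideal_squared_def splittings_def elim!: mult_nonzero_splits)+
qed

lemma zero_weight_space: "\<zero>\<^bsub>path_algebra G\<^esub> \<in> weight_space G w i"
  by (simp add: weight_space_def path_algebra_carrier path_algebra_apply)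

lemma path_elt_weight_space:
  assumes "arrow_sequence G es"
  shows "path_elt G es \<in> weight_space G w (int (sum_list (map w es)))"
  using assms
  by (auto simp: arrow_sequence_def weight_space_def path_algebra_carrier path_elt_def quiver_paths_def path_weight_def)

lemma path_elt_pow_weight_space:
  assumes "arrow_sequence G es"
  shows "path_elt G es [^]\<^bsub>path_algebra G\<^esub> k \<in> weight_space G w (int (k * sum_list (map w es)))"
proof (induction k)
  case 0
  interpret ring "path_algebra G :: ('c, ('a, 'b) quiver_path \<Rightarrow> 'c) module"
    by (rule ring_path_algebra)
  have "path_weight w x = 0" if "\<one>\<^bsub>path_algebra G\<^esub> x \<noteq> (0 :: 'c)" for x :: "('a, 'b) quiver_path"
    using that by (auto simp: path_algebra_apply path_weight_def split: if_splits)
  then show ?case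
    using one_closed by (simp add: weight_space_def)
next
  case (Suc k)
  interpret graded_algebra "path_algebra G :: ('c, ('a, 'b) quiver_path \<Rightarrow> 'c) module" "weight_part w"
    by (rule graded_path_algebra)
  show ?case
    using mult_homogeneous[unfolded homogeneous_weight_part, OF Suc path_elt_weight_space[OF assms]]
    by (simp add: algebra_simps)
qed

text \<open>
  The arrow \<open>e\<close> witnesses nontriviality: its class has positive degree, and it is nonzero because
  the ideal of relations consists of combinations of paths of length at least two.
\<close>

theorem quiver_algebra_positive_grading:
  fixes R :: "((('a, 'b) quiver_path \<Rightarrow> 'k :: field) \<times> (('a, 'b) quiver_path \<Rightarrow> 'k)) set"
  assumes hom: "\<forall>(x, y) \<in> R. \<exists>i. x \<in> weight_space G w i \<and> y \<in> weight_space G w i"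
    and long: "R \<subseteq> arrow_ideal_squared G \<times> arrow_ideal_squared G"
    and e: "e \<in> arcs G" "w e > 0"
  shows "\<exists>D. positive_grading (quiver_algebra G R) D \<and> nontrivial_grading (quiver_algebra G R) D"
proof -
  let ?P = "path_algebra G :: ('k, ('a, 'b) quiver_path \<Rightarrow> 'k) module"
  define S where "S = {x \<ominus>\<^bsub>?P\<^esub> y | x y. (x, y) \<in> R}"
  define I where "I = genideal ?P S"
  define D where "D i = (+>\<^bsub>?P\<^esub>) I ` weight_space G w i" for i
  interpret graded_algebra ?P "weight_part w"
    by (rule graded_path_algebra)
  have S: "\<exists>i. s \<in> homogeneous i" if s: "s \<in> S" for s
  proof -
    obtain x y i where "s = x \<ominus>\<^bsub>?P\<^esub> y" "x \<in> homogeneous i" "y \<in> homogeneous i"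
      using s hom unfolding S_def homogeneous_weight_part by blast
    then show ?thesis
      by (auto simp: homogeneous_def proj_minus intro: exI[of _ i])
  qed
  then have S_carr: "S \<subseteq> carrier ?P"
    by (auto simp: homogeneous_def)
  then interpret I: ideal I ?P
    unfolding I_def by (rule genideal_ideal)
  have Q: "quiver_algebra G R = quotient_algebra ?P I"
    by (simp add: quiver_algebra_def I_def S_def)
  interpret \<pi>: ring_hom_ring ?P "quiver_algebra G R" "(+>\<^bsub>?P\<^esub>) I"
    unfolding Q by (rule ring_quotient_algebra) (rule I.ideal_axioms)
  have zero: "\<zero>\<^bsub>quiver_algebra G R\<^esub> = I"
    unfolding Q quotient_algebra_def ring.extend_def FactRing_def by simp
  have proj_I: "weight_part w n x \<in> I" if "x \<in> I" for n x
    unfolding I_def by (rule proj_genideal, erule S) (rule that[unfolded I_def])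
  have "is_grading (quiver_algebra G R) D"
    unfolding Q D_def homogeneous_weight_part[symmetric]
    by (rule quotient_grading[OF I.ideal_axioms]) (rule proj_I)
  moreover have "D i = {\<zero>\<^bsub>quiver_algebra G R\<^esub>}" if "i < 0" for i
  proof -
    have "weight_space G w i = {\<zero>\<^bsub>?P\<^esub>}"
      using that by (auto simp: weight_space_def path_weight_def path_algebra_carrier path_algebra_apply fun_eq_iff)
    then show ?thesis
      unfolding D_def using \<pi>.hom_zero by simp
  qed
  moreover have "D (int (w e)) \<noteq> {\<zero>\<^bsub>quiver_algebra G R\<^esub>}"
  proof
    assume D: "D (int (w e)) = {\<zero>\<^bsub>quiver_algebra G R\<^esub>}"
    have "arrow_sequence G [e]"
      using e by (simp add: arrow_sequence_def awalk_def)
    from path_elt_weight_space[OF this, of w]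
    have e_weight: "(path_elt G [e] :: _ \<Rightarrow> 'k) \<in> weight_space G w (int (w e))"
      by simp
    then have "path_elt G [e] \<in> carrier ?P"
      by (simp add: weight_space_def)
    then have "path_elt G [e] \<in> I +>\<^bsub>?P\<^esub> path_elt G [e]"
      by (rule I.a_rcos_self)
    also have "\<dots> = I"
      using D e_weight unfolding D_def zero by blast
    also have "I \<subseteq> arrow_ideal_squared G"
    proof -
      interpret J: ideal "arrow_ideal_squared G" ?P
        by (rule ideal_arrow_ideal_squared)
      have "S \<subseteq> arrow_ideal_squared G"
        using long by (auto simp: S_def a_minus_def intro!: J.a_closed J.a_inv_closed)
      then show ?thesis
        unfolding I_def by (rule genideal_minimal[OF J.ideal_axioms])
    qed
    finally have "2 \<le> length (fst (snd x))" if "path_elt G [e] x \<noteq> (0 :: 'k)" for x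
      using that unfolding arrow_ideal_squared_def by blast
    from this[of "(tail G e, [e], head G e)"] show False
      by (simp add: path_elt_def)
  qed
  ultimately show ?thesis
    using e unfolding positive_grading_def nontrivial_grading_def
    by (intro exI[of _ D] conjI exI[of _ "int (w e)"]) auto
qed

end

section \<open>The three families\<close>

context fin_digraph
begin

lemma common_weight:
  "x \<in> weight_space G w i \<Longrightarrow> y \<in> weight_space G w j \<Longrightarrow> i = j \<Longrightarrow>
    \<exists>i. x \<in> weight_space G w i \<and> y \<in> weight_space G w i"
  by blast

lemma zero_relation:
  "arrow_sequence G es \<Longrightarrow>
    \<exists>i. path_elt G es \<in> weight_space G w i \<and> \<zero>\<^bsub>path_algebra G\<^esub> \<in> weight_space G w i"
  using path_elt_weight_space zero_weight_space by blast

text \<open>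
  The relations at hand equate a path with zero, or a path or a power of one with another. There is
  one rule for each such shape, so that a relation is checked by comparing weights.
\<close>

lemmas homogeneous_relation = zero_relation
  common_weight[OF path_elt_weight_space path_elt_weight_space]
  common_weight[OF path_elt_weight_space path_elt_pow_weight_space]
  common_weight[OF path_elt_pow_weight_space path_elt_weight_space]
  common_weight[OF path_elt_pow_weight_space path_elt_pow_weight_space]

lemmas in_arrow_ideal_squared =
  weight_space_length[OF _ path_elt_weight_space]
  weight_space_length[OF _ path_elt_pow_weight_space]
  weight_space_length[OF order_refl zero_weight_space]

end

lemmas quiver_simps = arrow_sequence_def pre_digraph.awalk_def pre_digraph.cas.simps quiver_def

lemma fin_digraph_families: "fin_digraph quiver_A" "fin_digraph quiver_B" "fin_digraph quiver_C"
  by unfold_locales (auto simp: quiver_A_def quiver_B_def quiver_C_def quiver_def)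

lemma algebra_A_positive_grading:
  assumes "r \<ge> 1"
  shows "\<exists>D. positive_grading (algebra_A r :: ('k :: field, _) module) D \<and>
             nontrivial_grading (algebra_A r :: ('k, _) module) D"
proof -
  interpret fin_digraph quiver_A
    by (rule fin_digraph_families)
  show ?thesis
    unfolding algebra_A_def Let_def
  proof (rule quiver_algebra_positive_grading[where w = "\<lambda>_. 1" and e = "a\<^sub>1"], goal_cases)
    case 1
    show ?case
      by (simp only: ball_simps case_prod_conv, intro conjI TrueI homogeneous_relation)
        (simp_all add: quiver_A_def quiver_simps)
  next
    case 2
    show ?case
      unfolding insert_subset mem_Times_iff fst_conv snd_conv
      by (intro conjI empty_subsetI in_arrow_ideal_squared)
        (use assms in \<open>simp_all add: quiver_A_def quiver_simps\<close>)
  qed (simp_all add: quiver_A_def quiver_def)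
qed

lemma algebra_B_positive_grading:
  assumes "r \<ge> 1"
  shows "\<exists>D. positive_grading (algebra_B r :: ('k :: field, _) module) D \<and>
             nontrivial_grading (algebra_B r :: ('k, _) module) D"
proof -
  interpret fin_digraph quiver_B
    by (rule fin_digraph_families)
  let ?w = "\<lambda>e. if e \<in> {c\<^sub>2, d\<^sub>2} then 1 else r"
  show ?thesis
    unfolding algebra_B_def Let_def
  proof (rule quiver_algebra_positive_grading[where w = ?w and e = "c\<^sub>2"], goal_cases)
    case 1
    show ?case
      by (simp only: ball_simps case_prod_conv, intro conjI TrueI homogeneous_relation)
        (simp_all add: quiver_B_def quiver_simps)
  next
    case 2
    show ?case
      unfolding insert_subset mem_Times_iff fst_conv snd_conv
      by (intro conjI empty_subsetI in_arrow_ideal_squared)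
        (use assms in \<open>simp_all add: quiver_B_def quiver_simps\<close>)
  qed (simp_all add: quiver_B_def quiver_def)
qed

lemma algebra_C_positive_grading:
  assumes "r \<ge> 1"
  shows "\<exists>D. positive_grading (algebra_C r :: ('k :: field, _) module) D \<and>
             nontrivial_grading (algebra_C r :: ('k, _) module) D"
proof (cases "r = 1")
  case True
  show ?thesis
    unfolding algebra_C_def if_P[OF True] by (rule algebra_A_positive_grading) simp
next
  case False
  interpret fin_digraph quiver_C
    by (rule fin_digraph_families)
  let ?w = "\<lambda>e. if e = c\<^sub>0 then 4 else r"
  show ?thesis
    unfolding algebra_C_def Let_def if_not_P[OF False]
  proof (rule quiver_algebra_positive_grading[where w = ?w and e = "c\<^sub>0"], goal_cases)
    case 1
    show ?case
      by (simp only: ball_simps case_prod_conv, intro conjI TrueI homogeneous_relation)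
        (simp_all add: quiver_C_def quiver_simps)
  next
    case 2
    show ?case
      unfolding insert_subset mem_Times_iff fst_conv snd_conv
      by (intro conjI empty_subsetI in_arrow_ideal_squared)
        (use assms False in \<open>simp_all add: quiver_C_def quiver_simps\<close>)
  qed (simp_all add: quiver_C_def quiver_def)
qed

theorem proposition3p6:
  fixes r :: nat
    and A :: "('k :: alg_closed_field, ((nat, arrow) quiver_path \<Rightarrow> 'k) set) module"
  assumes "CHAR('k) = 2"
    and "r \<ge> 1"
    and "A \<in> {algebra_A r, algebra_B r, algebra_C r}"
  shows "\<exists>G. positive_grading A G \<and> nontrivial_grading A G"
  using assms(3)
  by (elim insertE emptyE)
    (simp_all only: algebra_A_positive_grading[OF assms(2)] algebra_B_positive_grading[OF assms(2)]
      algebra_C_positive_grading[OF assms(2)])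

end
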